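(* In the payment network creation game with $n$ players, betweenness weight $b\ge 0$ and closeness weight $c$ with $c>1$ and $b\le c\le \frac12+b$, the price of anarchy is $$\mathrm{PoA}=\frac{\left(\frac12+(n-2)\,b\right) n}{1+\bigl(c+b(n-1)\bigr)(n-2)}.$$
   Context: Payment network creation game. There are $n\ge 2$ players $[n]=\{0,1,\dots,n-1\}$. A strategy of player $u$ is a set $s_u\subseteq [n]\setminus\{u\}$ (the players to whom $u$ opens a channel). A strategy combination is $s=(s_0,\dots,s_{n-1})$, and $G[s]$ is the undirected simple graph on $[n]$ in which $u,v$ are adjacent iff $v\in s_u$ or $u\in s_v$. With weights $b\ge 0$ and $c>0$, the cost of $u$ is $$\mathrm{cost}_u(s)=|s_u|+b\cdot \mathrm{betweenness}_u(s)+c\cdot \mathrm{closeness}_u(s),$$ $$\mathrm{betweenness}_u(s)=(n-1)(n-2)-\sum_{\substack{(i,j)\in[n]^2:\ i\ne j,\ i\neq u,\ j\ne u,\\ m(i,j)>0}}\frac{m_u(i,j)}{m(i,j)},\qquad \mathrm{closeness}_u(s)=\sum_{v\in[n]\setminus\{u\}}\bigl(d_{G[s]}(u,v)-1\bigr).$$ The sum in the betweenness runs over ordered pairs; $m(i,j)$ is the number of shortest paths between $i$ and $j$ in $G[s]$ and $m_u(i,j)$ the number of those passing through $u$; $d_{G[s]}$ is graph distance, equal to $\infty$ between different components. The social cost is $\mathrm{cost}(s)=\sum_{u}\mathrm{cost}_u(s)$. A strategy combination is a Nash equilibrium if no player can strictly decrease her cost by unilaterally changing her strategy; equilibrium graphs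 are taken to be connected (a player's cost is infinite in a disconnected graph, and disconnected strategy combinations are not regarded as equilibria). With $S$ the set of all strategy combinations and $N$ the set of Nash equilibria, $\mathrm{PoA}=\dfrac{\max_{s\in N}\mathrm{cost}(s)}{\min_{s\in S}\mathrm{cost}(s)}$. *)

theory Defs
  imports "Graph_Theory.Graph_Theory"
begin

definition strategies :: "nat \<Rightarrow> nat \<Rightarrow> nat set set" where
  "strategies n u = Pow ({..<n} - {u})"

definition strategy_profiles :: "nat \<Rightarrow> (nat \<Rightarrow> nat set) set" where
  "strategy_profiles n = (\<Pi>\<^sub>E u\<in>{..<n}. strategies n u)"

text \<open>
  An undirected simple graph is represented, as usual in this library, by a finite symmetric
  loop-free digraph: every edge is present as a pair of opposite arcs.
\<close>

definition channel_graph :: "nat \<Rightarrow> (nat \<Rightarrow> nat set) \<Rightarrow> nat pair_pre_digraph" where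
  "channel_graph n s =
     \<lparr> pverts = {..<n},
       parcs = {(u, v). u < n \<and> v < n \<and> u \<noteq> v \<and> (v \<in> s u \<or> u \<in> s v)} \<rparr>"

lemma pair_graph_channel_graph: "pair_graph (channel_graph n s)"
proof -
  have "finite (parcs (channel_graph n s))"
    by (rule finite_subset[of _ "{..<n} \<times> {..<n}"]) (auto simp: channel_graph_def)
  then show ?thesis
    by unfold_locales (auto simp: channel_graph_def symmetric_def sym_def)
qed

text \<open>
  The distance is the infimum of the lengths of all walks, hence \<open>\<infinity>\<close> between different
  components.
\<close>

definition graph_dist :: "nat \<Rightarrow> (nat \<Rightarrow> nat set) \<Rightarrow> nat \<Rightarrow> nat \<Rightarrow> ereal" where
  "graph_dist n s i j = wf_digraph.\<mu> (with_proj (channel_graph n s)) (\<lambda>_. 1) i j"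

definition shortest_paths :: "nat \<Rightarrow> (nat \<Rightarrow> nat set) \<Rightarrow> nat \<Rightarrow> nat \<Rightarrow> (nat \<times> nat) awalk set" where
  "shortest_paths n s i j =
     {p. pre_digraph.apath (with_proj (channel_graph n s)) i p j
         \<and> ereal (real (length p)) = graph_dist n s i j}"

definition num_sp :: "nat \<Rightarrow> (nat \<Rightarrow> nat set) \<Rightarrow> nat \<Rightarrow> nat \<Rightarrow> nat" where
  "num_sp n s i j = card (shortest_paths n s i j)"

definition num_sp_through :: "nat \<Rightarrow> (nat \<Rightarrow> nat set) \<Rightarrow> nat \<Rightarrow> nat \<Rightarrow> nat \<Rightarrow> nat" where
  "num_sp_through n s u i j =
     card {p \<in> shortest_paths n s i j.
             u \<in> set (pre_digraph.awalk_verts (with_proj (channel_graph n s)) i p)}"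

lemma finite_shortest_paths: "finite (shortest_paths n s i j)"
proof -
  interpret pair_graph "channel_graph n s" by (rule pair_graph_channel_graph)
  show ?thesis
    by (rule finite_subset[OF _ apaths_finite[of i j]]) (auto simp: shortest_paths_def)
qed

definition betweenness :: "nat \<Rightarrow> (nat \<Rightarrow> nat set) \<Rightarrow> nat \<Rightarrow> real" where
  "betweenness n s u =
     (real n - 1) * (real n - 2)
     - (\<Sum>(i, j)\<in>{(i, j). i < n \<and> j < n \<and> i \<noteq> j \<and> i \<noteq> u \<and> j \<noteq> u \<and> num_sp n s i j > 0}.
          real (num_sp_through n s u i j) / real (num_sp n s i j))"

definition closeness :: "nat \<Rightarrow> (nat \<Rightarrow> nat set) \<Rightarrow> nat \<Rightarrow> ereal" where
  "closeness n s u = (\<Sum>v\<in>{..<n} - {u}. graph_dist n s u v - 1)"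

definition player_cost ::
  "nat \<Rightarrow> real \<Rightarrow> real \<Rightarrow> (nat \<Rightarrow> nat set) \<Rightarrow> nat \<Rightarrow> ereal" where
  "player_cost n b c s u =
     ereal (real (card (s u))) + ereal b * ereal (betweenness n s u) + ereal c * closeness n s u"

definition social_cost :: "nat \<Rightarrow> real \<Rightarrow> real \<Rightarrow> (nat \<Rightarrow> nat set) \<Rightarrow> ereal" where
  "social_cost n b c s = (\<Sum>u<n. player_cost n b c s u)"

text \<open>
  Connectedness is imposed as a convention; in a disconnected graph every player has cost
  \<open>\<infinity>\<close> for \<open>c > 0\<close>.
\<close>

definition nash_equilibria :: "nat \<Rightarrow> real \<Rightarrow> real \<Rightarrow> (nat \<Rightarrow> nat set) set" where
  "nash_equilibria n b c =
     {s \<in> strategy_profiles n.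
        Digraph_Component.connected (with_proj (channel_graph n s))
        \<and> (\<forall>u<n. \<forall>t\<in>strategies n u.
              \<not> player_cost n b c (s(u := t)) u < player_cost n b c s u)}"

lemma finite_strategy_profiles: "finite (strategy_profiles n)"
  by (auto simp: strategy_profiles_def strategies_def intro!: finite_PiE)

lemma finite_nash_equilibria: "finite (nash_equilibria n b c)"
  by (rule finite_subset[OF _ finite_strategy_profiles]) (auto simp: nash_equilibria_def)

definition PoA :: "nat \<Rightarrow> real \<Rightarrow> real \<Rightarrow> ereal" where
  "PoA n b c =
     Max (social_cost n b c ` nash_equilibria n b c)
     / Min (social_cost n b c ` strategy_profiles n)"

end

(*
  Summed over all players u, the fractions m_u(i,j)/m(i,j) of a connected graph add up to
  d(i,j) - 1, as every shortest path from i to j has d(i,j) - 1 inner vertices. With D the sum of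
  d(i,j) - 1 over all ordered pairs and K the number of channels opened, the social cost is
  therefore K + b n (n-1) (n-2) + (c-b) D.

  Minimum: non-adjacent players have distance at least 2 and 2K is at least the number a of arcs,
  so the cost is at least a/2 + (c-b) (n (n-1) - a) plus a constant. As c - b <= 1/2, this
  increases with a, and a >= 2 (n-1) by connectedness; the star attains equality throughout.

  Equilibria: a player u gains more than 1 in closeness by a new channel, since c > 1, and
  all new shortest paths run through u, so her betweenness cost cannot grow. Hence equilibria are
  complete graphs without doubly opened channels, and all of them have the same cost.
  Conversely, in such a graph each closed channel costs c > 1 and saves 1, and the other players remain
  a clique, so no shortest path between them can run through u.
*)

theory Submission
  imports Defs
begin

section \<open>Notation, arcs and ordered pairs of players\<close>

abbreviation net :: "nat \<Rightarrow> (nat \<Rightarrow> nat set) \<Rightarrow> (nat, nat \<times> nat) pre_digraph" where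
  "net n s \<equiv> with_proj (channel_graph n s)"

abbreviation walk :: "nat \<Rightarrow> (nat \<Rightarrow> nat set) \<Rightarrow> nat \<Rightarrow> (nat \<times> nat) list \<Rightarrow> nat \<Rightarrow> bool" where
  "walk n s \<equiv> pre_digraph.awalk (net n s)"

abbreviation path :: "nat \<Rightarrow> (nat \<Rightarrow> nat set) \<Rightarrow> nat \<Rightarrow> (nat \<times> nat) list \<Rightarrow> nat \<Rightarrow> bool" where
  "path n s \<equiv> pre_digraph.apath (net n s)"

text \<open>The vertex list without reference to a graph, so that one arc list can be compared in
  two profiles; \<open>awalk_verts_net\<close> links it to the library notion.\<close>

definition walk_verts :: "nat \<Rightarrow> (nat \<times> nat) list \<Rightarrow> nat list" where
  "walk_verts i p = (if p = [] then [i] else map fst p @ [snd (last p)])"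

abbreviation arcset :: "nat \<Rightarrow> (nat \<Rightarrow> nat set) \<Rightarrow> (nat \<times> nat) set" where
  "arcset n s \<equiv> parcs (channel_graph n s)"

text \<open>Meaningful for connected graphs only: an infinite distance is turned into 0.\<close>
abbreviation hops :: "nat \<Rightarrow> (nat \<Rightarrow> nat set) \<Rightarrow> nat \<Rightarrow> nat \<Rightarrow> real" where
  "hops n s i j \<equiv> real_of_ereal (graph_dist n s i j)"

definition pairs :: "nat \<Rightarrow> (nat \<times> nat) set" where
  "pairs n = {(i, j). i < n \<and> j < n \<and> i \<noteq> j}"

text \<open>Connectedness in the form in which the cost depends on it. For \<open>0 < n\<close> it
  agrees with the library's notion, by \<open>connected_imp_conn\<close> and
  \<open>conn_imp_connected\<close>.\<close>

definition conn :: "nat \<Rightarrow> (nat \<Rightarrow> nat set) \<Rightarrow> bool" where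
  "conn n s \<longleftrightarrow> (\<forall>i<n. \<forall>j<n. graph_dist n s i j < \<infinity>)"

lemma awalk_verts_net: "pre_digraph.awalk_verts (net n s) i p = walk_verts i p"
  by (simp add: pre_digraph.awalk_verts_conv walk_verts_def)

lemma wf_digraph_net: "wf_digraph (net n s)"
proof -
  interpret pair_graph "channel_graph n s" by (rule pair_graph_channel_graph)
  show ?thesis ..
qed

lemma mem_arcset_iff:
  "(u, v) \<in> arcset n s \<longleftrightarrow> u < n \<and> v < n \<and> u \<noteq> v \<and> (v \<in> s u \<or> u \<in> s v)"
  by (simp add: channel_graph_def)

lemma arcset_sym: "(u, v) \<in> arcset n s \<Longrightarrow> (v, u) \<in> arcset n s"
  by (auto simp: mem_arcset_iff)

lemma arcset_subset_pairs: "arcset n s \<subseteq> pairs n"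
  by (auto simp: channel_graph_def pairs_def)

lemma finite_pairs [simp]: "finite (pairs n)"
  by (rule finite_subset[of _ "{..<n} \<times> {..<n}"]) (auto simp: pairs_def)

lemma finite_arcset [simp]: "finite (arcset n s)"
  by (rule finite_subset[OF arcset_subset_pairs]) simp

lemma pairs_Sigma: "pairs n = (SIGMA i:{..<n}. {..<n} - {i})"
  by (auto simp: pairs_def)

lemma card_pairs: "card (pairs n) = n * (n - 1)"
  by (simp add: pairs_Sigma)

lemma real_card_pairs: "real (card (pairs n)) = real n * (real n - 1)"
  by (cases n) (simp_all add: card_pairs algebra_simps)

lemma sum_pairs: "(\<Sum>x\<in>pairs n. f x) = (\<Sum>i<n. \<Sum>j\<in>{..<n} - {i}. f (i, j))"
  by (simp add: pairs_Sigma sum.Sigma)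

section \<open>Walks and distances\<close>

lemma cas_net_cong: "pre_digraph.cas (net n s) i p j = pre_digraph.cas (net n t) i p j"
  by (induction p arbitrary: i) (simp_all add: pre_digraph.cas.simps)

text \<open>The graphs of two profiles share vertices, tails and heads, so only membership of the
  arcs has to be checked.\<close>

lemma walk_mono:
  assumes "walk n s i p j" "set p \<subseteq> arcset n t"
  shows "walk n t i p j"
  using assms cas_net_cong[of n s i p j t]
  by (auto simp: pre_digraph.awalk_def channel_graph_def)

lemma path_mono:
  assumes "path n s i p j" "set p \<subseteq> arcset n t"
  shows "path n t i p j"
  using assms walk_mono[of n s i p j t] by (auto simp: pre_digraph.apath_def awalk_verts_net)

lemma walk_arcs: "walk n s i p j \<Longrightarrow> set p \<subseteq> arcset n s"
  by (simp add: pre_digraph.awalk_def)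

lemma path_arcs: "path n s i p j \<Longrightarrow> set p \<subseteq> arcset n s"
  by (simp add: pre_digraph.awalk_def pre_digraph.apath_def)

lemma walk_cost: "wf_digraph.awalk_cost (\<lambda>_. 1) (p :: (nat \<times> nat) list) = real (length p)"
proof -
  \<comment> \<open>\<open>awalk_cost\<close> mentions no graph; any instance of the locale gives
    access to its recursion equations.\<close>
  interpret pair_graph "channel_graph 0 (\<lambda>_. {})" by (rule pair_graph_channel_graph)
  show ?thesis by (induction p) simp_all
qed

lemma graph_dist_le:
  assumes "walk n s i p j"
  shows "graph_dist n s i j \<le> ereal (length p)"
proof -
  interpret pair_graph "channel_graph n s" by (rule pair_graph_channel_graph)
  show ?thesis
    using min_cost_le_walk_cost[OF assms, of "\<lambda>_. 1"] by (simp add: graph_dist_def walk_cost)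
qed

lemma graph_dist_greatest:
  assumes "\<And>p. walk n s i p j \<Longrightarrow> a \<le> ereal (length p)"
  shows "a \<le> graph_dist n s i j"
proof -
  interpret pair_graph "channel_graph n s" by (rule pair_graph_channel_graph)
  show ?thesis
    unfolding graph_dist_def \<mu>_def using assms by (intro INF_greatest) (simp add: walk_cost)
qed

text \<open>A finite distance means reachability, and for the nonnegative unit costs the infimum
  over walks is then attained by a path.\<close>

lemma graph_dist_attained:
  assumes "graph_dist n s i j < \<infinity>"
  obtains p where "path n s i p j" "graph_dist n s i j = ereal (length p)"
proof -
  interpret pair_graph "channel_graph n s" by (rule pair_graph_channel_graph)
  show ?thesis
    using min_cost_awalk[of i j "\<lambda>_. 1"] assms that
    unfolding graph_dist_def walk_cost \<mu>_reach_conv by auto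
qed

lemma graph_dist_mono:
  assumes "arcset n s \<subseteq> arcset n t"
  shows "graph_dist n t i j \<le> graph_dist n s i j"
proof (rule graph_dist_greatest)
  fix p assume p: "walk n s i p j"
  then have "walk n t i p j" using assms walk_arcs by (intro walk_mono[OF p]) blast
  then show "graph_dist n t i j \<le> ereal (length p)" by (rule graph_dist_le)
qed

lemma walk_neq_nonempty: "walk n s i p j \<Longrightarrow> i \<noteq> j \<Longrightarrow> p \<noteq> []"
  by (auto simp: pre_digraph.awalk_def pre_digraph.cas.simps)

lemma graph_dist_nonneg: "0 \<le> graph_dist n s i j"
  by (rule graph_dist_greatest) simp

lemma graph_dist_ge_1:
  assumes "i \<noteq> j"
  shows "1 \<le> graph_dist n s i j"
proof (rule graph_dist_greatest)
  fix p assume "walk n s i p j"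
  then have "p \<noteq> []" using assms by (rule walk_neq_nonempty)
  then show "1 \<le> ereal (length p)" by (cases p) auto
qed

lemma graph_dist_ge_2:
  assumes "i \<noteq> j" "(i, j) \<notin> arcset n s"
  shows "2 \<le> graph_dist n s i j"
proof (rule graph_dist_greatest)
  fix p assume p: "walk n s i p j"
  have "length p \<noteq> 0" "length p \<noteq> 1"
    using p assms by (auto simp: pre_digraph.awalk_def pre_digraph.cas.simps length_Suc_conv)
  then have "2 \<le> length p" by linarith
  then show "2 \<le> ereal (length p)" by simp
qed

lemma graph_dist_self: "i < n \<Longrightarrow> graph_dist n s i i = 0"
  using graph_dist_le[of n s i "[]" i] graph_dist_nonneg[of n s i i]
  by (simp add: pre_digraph.awalk_def pre_digraph.cas.simps channel_graph_def zero_ereal_def)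

lemma graph_dist_adjacent:
  assumes "(i, j) \<in> arcset n s"
  shows "graph_dist n s i j = 1"
proof (rule antisym)
  have "walk n s i [(i, j)] j"
    using assms by (simp add: pre_digraph.awalk_def pre_digraph.cas.simps channel_graph_def)
  from graph_dist_le[OF this] show "graph_dist n s i j \<le> 1" by (simp add: one_ereal_def)
  show "1 \<le> graph_dist n s i j" using assms by (intro graph_dist_ge_1) (auto simp: mem_arcset_iff)
qed

lemma graph_dist_le_2:
  assumes "(i, k) \<in> arcset n s" "(k, j) \<in> arcset n s"
  shows "graph_dist n s i j \<le> 2"
proof -
  have "walk n s i [(i, k), (k, j)] j"
    using assms by (simp add: pre_digraph.awalk_def pre_digraph.cas.simps channel_graph_def)
  from graph_dist_le[OF this] show ?thesis by simp
qed

lemma conn_hops: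
  assumes "conn n s" "i < n" "j < n"
  shows "graph_dist n s i j = ereal (hops n s i j)"
  using assms graph_dist_nonneg[of n s i j]
  by (cases "graph_dist n s i j") (auto simp: conn_def)

lemma hops_ge_2:
  assumes "conn n s" "i < n" "j < n" "i \<noteq> j" "(i, j) \<notin> arcset n s"
  shows "2 \<le> hops n s i j"
  using graph_dist_ge_2[OF assms(4,5)] conn_hops[OF assms(1-3)]
  by (cases "graph_dist n s i j") auto

text \<open>The arc set is symmetric, so connectedness is already strong connectedness, and
  reachable vertices have finite distance.\<close>

lemma connected_imp_conn:
  assumes "Digraph_Component.connected (net n s)"
  shows "conn n s"
proof -
  interpret pair_graph "channel_graph n s" by (rule pair_graph_channel_graph)
  have "strongly_connected (net n s)"
    using assms by (intro symmetric_connected_imp_strongly_connected) (rule sym_arcs)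
  then show ?thesis
    unfolding conn_def graph_dist_def \<mu>_reach_conv
    by (auto simp: strongly_connected_def channel_graph_def)
qed

lemma conn_imp_connected:
  assumes "conn n s" "0 < n"
  shows "Digraph_Component.connected (net n s)"
proof -
  interpret pair_graph "channel_graph n s" by (rule pair_graph_channel_graph)
  have "i \<rightarrow>\<^sup>*\<^bsub>net n s\<^esub> j" if "i < n" "j < n" for i j
    using assms(1) that unfolding conn_def graph_dist_def \<mu>_reach_conv by blast
  then show ?thesis
    using assms(2) reachable_mk_symmetricI
    unfolding Digraph_Component.connected_def strongly_connected_def
    by (auto simp: channel_graph_def)
qed

section \<open>Shortest paths through a player, and betweenness\<close>

lemma shortest_paths_iff:
  assumes "graph_dist n s i j = ereal (real d)"
  shows "p \<in> shortest_paths n s i j \<longleftrightarrow> path n s i p j \<and> length p = d"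
  using assms by (auto simp: shortest_paths_def)

lemma num_sp_pos:
  assumes "graph_dist n s i j < \<infinity>"
  shows "0 < num_sp n s i j"
proof -
  obtain p where "path n s i p j" "graph_dist n s i j = ereal (length p)"
    using graph_dist_attained[OF assms] by blast
  then have "p \<in> shortest_paths n s i j" by (simp add: shortest_paths_def)
  then show ?thesis by (auto simp: num_sp_def card_gt_0_iff finite_shortest_paths)
qed

text \<open>A path has \<open>length p + 1\<close> distinct vertices, two of which are its
  ends.\<close>

lemma card_inner_verts:
  assumes "path n s i p j" "i \<noteq> j"
  shows "card {u \<in> {..<n} - {i, j}. u \<in> set (walk_verts i p)} = length p - 1"
proof -
  let ?vs = "pre_digraph.awalk_verts (net n s) i p"
  have w: "walk n s i p j" and d: "distinct ?vs"
    using assms(1) by (simp_all only: pre_digraph.apath_def)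
  have "hd ?vs = i" "last ?vs = j" "set ?vs \<subseteq> {..<n}"
    using w by (simp_all only: wf_digraph.awalk_conv[OF wf_digraph_net]) (simp add: channel_graph_def)
  moreover have "?vs \<noteq> []" by (rule pre_digraph.awalk_verts_non_Nil)
  ultimately have "{i, j} \<subseteq> set ?vs" "set ?vs \<subseteq> {..<n}"
    using hd_in_set[of ?vs] last_in_set[of ?vs] by simp_all
  moreover have "card (set ?vs) = Suc (length p)"
    using distinct_card[OF d] by (simp only: pre_digraph.length_awalk_verts)
  moreover have "{u \<in> {..<n} - {i, j}. u \<in> set ?vs} = set ?vs - {i, j}"
    using \<open>set ?vs \<subseteq> {..<n}\<close> by blast
  ultimately have "card {u \<in> {..<n} - {i, j}. u \<in> set ?vs} = length p - 1"
    using assms(2) by (simp add: card_Diff_subset)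
  then show ?thesis by (simp only: awalk_verts_net)
qed

text \<open>Double counting of the incidences between shortest paths and their inner vertices: each
  shortest path has \<open>d - 1\<close> of these.\<close>

lemma sum_num_sp_through:
  assumes "graph_dist n s i j < \<infinity>" "i \<noteq> j"
  shows "(\<Sum>u\<in>{..<n} - {i, j}. real (num_sp_through n s u i j))
           = real (num_sp n s i j) * (hops n s i j - 1)"
proof -
  obtain p where p: "path n s i p j" "graph_dist n s i j = ereal (length p)"
    using graph_dist_attained[OF assms(1)] by blast
  define d where "d = length p"
  have d: "graph_dist n s i j = ereal d" using p by (simp add: d_def)
  \<comment> \<open>Makes the natural subtraction \<open>d - 1\<close> agree with the real one at
    the end.\<close>
  have "1 \<le> d" using graph_dist_ge_1[OF assms(2), of n s] d by simp
  have "(\<Sum>u\<in>{..<n} - {i, j}. num_sp_through n s u i j) = (d - 1) * num_sp n s i j"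
    unfolding num_sp_through_def num_sp_def
  proof (rule sum_multicount[OF _ finite_shortest_paths], safe)
    fix p assume "p \<in> shortest_paths n s i j"
    then have "path n s i p j" "length p = d" by (simp_all only: shortest_paths_iff[OF d])
    then show "card {u \<in> {..<n} - {i, j}. u \<in> set (pre_digraph.awalk_verts (net n s) i p)} = d - 1"
      using card_inner_verts[of n s i p j] assms(2) unfolding awalk_verts_net by blast
  qed simp
  then have "real (\<Sum>u\<in>{..<n} - {i, j}. num_sp_through n s u i j) = real ((d - 1) * num_sp n s i j)"
    by (simp only:)
  then show ?thesis using \<open>1 \<le> d\<close> by (simp add: d of_nat_diff)
qed

text \<open>The value 0 at the two ends lets every player sum over the same set
  \<open>pairs n\<close>, so that sums over players and over pairs can be exchanged.\<close>

definition through_ratio :: "nat \<Rightarrow> (nat \<Rightarrow> nat set) \<Rightarrow> nat \<Rightarrow> nat \<Rightarrow> nat \<Rightarrow> real" where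
  "through_ratio n s u i j =
     (if u = i \<or> u = j then 0 else real (num_sp_through n s u i j) / real (num_sp n s i j))"

lemma betweenness_eq:
  "betweenness n s u = (real n - 1) * (real n - 2) - (\<Sum>(i, j)\<in>pairs n. through_ratio n s u i j)"
proof -
  have "(\<Sum>(i, j)\<in>{(i, j). i < n \<and> j < n \<and> i \<noteq> j \<and> i \<noteq> u \<and> j \<noteq> u \<and> num_sp n s i j > 0}.
          real (num_sp_through n s u i j) / real (num_sp n s i j))
        = (\<Sum>(i, j)\<in>pairs n. through_ratio n s u i j)"
  proof (rule sum.mono_neutral_cong_left[OF finite_pairs])
    \<comment> \<open>A pair without shortest paths contributes 0 here as well, since division by
      zero yields 0.\<close>
    show "\<forall>x\<in>pairs n - {(i, j). i < n \<and> j < n \<and> i \<noteq> j \<and> i \<noteq> u \<and> j \<noteq> u \<and> num_sp n s i j > 0}.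
            (case x of (i, j) \<Rightarrow> through_ratio n s u i j) = 0"
      by (auto simp: pairs_def through_ratio_def split: if_splits)
    show "{(i, j). i < n \<and> j < n \<and> i \<noteq> j \<and> i \<noteq> u \<and> j \<noteq> u \<and> num_sp n s i j > 0} \<subseteq> pairs n"
      by (auto simp: pairs_def)
  qed (auto simp: through_ratio_def split: if_splits)
  then show ?thesis by (simp add: betweenness_def)
qed

lemma sum_through_ratio:
  assumes "conn n s" "(i, j) \<in> pairs n"
  shows "(\<Sum>u<n. through_ratio n s u i j) = hops n s i j - 1"
proof -
  have fin: "graph_dist n s i j < \<infinity>" and "i \<noteq> j" using assms by (auto simp: conn_def pairs_def)
  have "(\<Sum>u<n. through_ratio n s u i j)
          = (\<Sum>u\<in>{..<n} - {i, j}. real (num_sp_through n s u i j) / real (num_sp n s i j))"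
    by (rule sum.mono_neutral_cong_right) (auto simp: through_ratio_def)
  also have "\<dots> = (\<Sum>u\<in>{..<n} - {i, j}. real (num_sp_through n s u i j)) / real (num_sp n s i j)"
    by (simp only: sum_divide_distrib)
  also have "\<dots> = hops n s i j - 1"
    using num_sp_pos[OF fin] by (simp add: sum_num_sp_through[OF fin \<open>i \<noteq> j\<close>])
  finally show ?thesis .
qed

section \<open>Social cost in terms of channels and distances\<close>

definition stretch :: "nat \<Rightarrow> (nat \<Rightarrow> nat set) \<Rightarrow> real" where
  "stretch n s = (\<Sum>(i, j)\<in>pairs n. hops n s i j - 1)"

lemma sum_betweenness:
  assumes "conn n s"
  shows "(\<Sum>u<n. betweenness n s u) = real n * (real n - 1) * (real n - 2) - stretch n s"
proof -
  have "(\<Sum>u<n. \<Sum>(i, j)\<in>pairs n. through_ratio n s u i j)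
          = (\<Sum>(i, j)\<in>pairs n. \<Sum>u<n. through_ratio n s u i j)"
    unfolding case_prod_beta by (rule sum.swap)
  also have "\<dots> = stretch n s"
    unfolding stretch_def using sum_through_ratio[OF assms] by (intro sum.cong) auto
  finally show ?thesis by (simp add: betweenness_eq sum_subtractf)
qed

lemma closeness_conn:
  assumes "conn n s" "u < n"
  shows "closeness n s u = ereal (\<Sum>v\<in>{..<n} - {u}. hops n s u v - 1)"
proof -
  have "graph_dist n s u v - 1 = ereal (hops n s u v - 1)" if "v < n" for v
    using conn_hops[OF assms that] by (cases "graph_dist n s u v") (auto simp: one_ereal_def)
  then show ?thesis by (simp add: closeness_def)
qed

lemma player_cost_conn:
  assumes "conn n s" "u < n"
  shows "player_cost n b c s u = ereal (real (card (s u)) + b * betweenness n s u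
           + c * (\<Sum>v\<in>{..<n} - {u}. hops n s u v - 1))"
  using assms by (simp add: player_cost_def closeness_conn)

text \<open>Closeness contributes \<open>c * stretch n s\<close> and betweenness takes off
  \<open>b * stretch n s\<close>; apart from the number of channels nothing else varies with the
  profile.\<close>

lemma social_cost_conn:
  assumes "conn n s"
  shows "social_cost n b c s = ereal (real (\<Sum>u<n. card (s u))
           + b * (real n * (real n - 1) * (real n - 2)) + (c - b) * stretch n s)"
proof -
  have "social_cost n b c s = ereal (\<Sum>u<n. real (card (s u)) + b * betweenness n s u
           + c * (\<Sum>v\<in>{..<n} - {u}. hops n s u v - 1))"
    by (simp add: social_cost_def player_cost_conn[OF assms])
  also have "(\<Sum>u<n. real (card (s u)) + b * betweenness n s u
           + c * (\<Sum>v\<in>{..<n} - {u}. hops n s u v - 1))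
      = real (\<Sum>u<n. card (s u)) + b * (\<Sum>u<n. betweenness n s u) + c * stretch n s"
    unfolding stretch_def sum_pairs by (simp add: sum.distrib sum_distrib_left)
  finally show ?thesis by (simp add: sum_betweenness[OF assms] algebra_simps)
qed

lemma closeness_nonneg: "0 \<le> closeness n s u"
proof -
  have "0 \<le> graph_dist n s u v - 1" if "v \<in> {..<n} - {u}" for v
    using graph_dist_ge_1[of u v n s] that by (simp add: ereal_diff_positive)
  then show ?thesis unfolding closeness_def by (rule sum_nonneg)
qed

text \<open>One infinite distance makes one closeness infinite. The factor \<open>c\<close> must be
  positive, as 0 times infinity is 0 in \<open>ereal\<close>.\<close>

lemma social_cost_not_conn:
  assumes "\<not> conn n s" "0 < c"
  shows "social_cost n b c s = \<infinity>"
proof -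
  obtain u v where "u < n" "v < n" and inf: "graph_dist n s u v = \<infinity>"
    using assms(1) by (auto simp: conn_def)
  then have "v \<in> {..<n} - {u}" using graph_dist_self[of u n s] by auto
  then have "closeness n s u = \<infinity>"
    unfolding closeness_def sum_Pinfty using inf by (auto intro: bexI[of _ v])
  then have "player_cost n b c s u = \<infinity>" using assms(2) by (simp add: player_cost_def)
  then show ?thesis unfolding social_cost_def sum_Pinfty using \<open>u < n\<close> by blast
qed

section \<open>Effect of a new channel on betweenness\<close>

text \<open>Both new arcs touch \<open>u\<close>, so a shortest path of \<open>t\<close> avoiding
  \<open>u\<close> is already a shortest path of \<open>s\<close>: the number of avoiding paths
  cannot grow. If \<open>t\<close> has such a path, the distance is unchanged and the total number
  of shortest paths cannot drop, so the share of avoiding paths cannot grow either.\<close>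

lemma through_ratio_add_edge:
  assumes arcs: "arcset n t = arcset n s \<union> {(u, v), (v, u)}"
    and fin: "graph_dist n s i j < \<infinity>"
  shows "through_ratio n s u i j \<le> through_ratio n t u i j"
proof (cases "u = i \<or> u = j")
  case False
  define A where "A = {p \<in> shortest_paths n s i j. u \<in> set (walk_verts i p)}"
  define B where "B = {p \<in> shortest_paths n t i j. u \<in> set (walk_verts i p)}"
  define m where "m = num_sp n s i j"
  define m' where "m' = num_sp n t i j"
  have le: "graph_dist n t i j \<le> graph_dist n s i j"
    using arcs by (intro graph_dist_mono) blast
  then have "0 < m" "0 < m'" using fin num_sp_pos[of n s i j] num_sp_pos[of n t i j]
    by (auto simp: m_def m'_def simp del: ereal_infty_less)
  have old: "path n s i p j \<and> graph_dist n s i j = graph_dist n t i j"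
    if "p \<in> shortest_paths n t i j - B" for p
  proof -
    have p: "path n t i p j" "ereal (length p) = graph_dist n t i j" "u \<notin> set (walk_verts i p)"
      using that by (auto simp: B_def shortest_paths_def)
    have w: "walk n t i p j" using p(1) by (simp add: pre_digraph.apath_def)
    \<comment> \<open>Both ends of every arc of \<open>p\<close> are vertices of \<open>p\<close>,
      so an arc at \<open>u\<close> would put \<open>u\<close> on the path.\<close>
    have "fst e \<noteq> u \<and> snd e \<noteq> u" if "e \<in> set p" for e
    proof -
      have "tail (net n t) e \<in> set (walk_verts i p)" "head (net n t) e \<in> set (walk_verts i p)"
        unfolding awalk_verts_net[of n t, symmetric]
        by (rule wf_digraph.awalk_verts_arc1[OF wf_digraph_net that])
          (rule wf_digraph.awalk_verts_arc2[OF wf_digraph_net w that])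
      then show ?thesis using p(3) by auto
    qed
    then have "set p \<subseteq> arcset n s" using path_arcs[OF p(1)] arcs by force
    then have "path n s i p j" by (rule path_mono[OF p(1)])
    moreover from this have "graph_dist n s i j \<le> ereal (length p)"
      by (intro graph_dist_le) (simp add: pre_digraph.apath_def)
    ultimately show ?thesis using p(2) le by auto
  qed
  then have sub: "shortest_paths n t i j - B \<subseteq> shortest_paths n s i j - A"
    by (force simp: shortest_paths_def A_def B_def)
  have "card (shortest_paths n t i j - B) \<le> card (shortest_paths n s i j - A)"
    by (intro card_mono sub finite_Diff finite_shortest_paths)
  moreover have "A \<subseteq> shortest_paths n s i j" "B \<subseteq> shortest_paths n t i j"
    by (auto simp: A_def B_def)
  moreover from this have "card A \<le> m" "card B \<le> m'"
    by (auto simp: m_def m'_def num_sp_def intro!: card_mono finite_shortest_paths)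
  ultimately have avoid: "real m' - card B \<le> real m - card A"
    by (simp add: card_Diff_subset finite_subset[OF _ finite_shortest_paths]
          m_def m'_def num_sp_def)
  \<comment> \<open>Comparison of the complementary shares, those of the shortest paths avoiding
    \<open>u\<close>.\<close>
  have "(real m' - card B) / m' \<le> (real m - card A) / m"
  proof (cases "shortest_paths n t i j - B = {}")
    case True
    then have "B = shortest_paths n t i j" by (auto simp: B_def)
    then have "real m' - card B = 0" by (simp add: m'_def num_sp_def)
    moreover have "0 \<le> (real m - card A) / m" using \<open>card A \<le> m\<close> by simp
    ultimately show ?thesis by simp
  next
    case False
    \<comment> \<open>With equal distances every shortest path of \<open>s\<close> remains one of
      \<open>t\<close>, which bounds the denominators.\<close>
    then have "graph_dist n s i j = graph_dist n t i j" using old by blast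
    then have "shortest_paths n s i j \<subseteq> shortest_paths n t i j"
      using path_mono[of n s i _ j t] path_arcs arcs by (fastforce simp: shortest_paths_def)
    then have "m \<le> m'"
      by (simp add: m_def m'_def num_sp_def card_mono finite_shortest_paths)
    then show ?thesis using avoid \<open>card A \<le> m\<close> \<open>0 < m\<close> by (intro frac_le) auto
  qed
  then have "card A / m \<le> card B / m'"
    using \<open>0 < m\<close> \<open>0 < m'\<close> by (simp add: diff_divide_distrib)
  then show ?thesis
    using False by (simp add: through_ratio_def num_sp_through_def A_def B_def m_def m'_def awalk_verts_net)
qed (auto simp: through_ratio_def)

lemma betweenness_add_edge:
  assumes "arcset n t = arcset n s \<union> {(u, v), (v, u)}" "conn n s"
  shows "betweenness n t u \<le> betweenness n s u"
proof -
  have "(\<Sum>(i, j)\<in>pairs n. through_ratio n s u i j) \<le> (\<Sum>(i, j)\<in>pairs n. through_ratio n t u i j)"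
    using assms(2) by (intro sum_mono) (auto simp: pairs_def conn_def intro!: through_ratio_add_edge[OF assms(1)])
  then show ?thesis by (simp add: betweenness_eq)
qed

text \<open>Who opened a channel matters only for its price; this serves for channels opened from
  both ends.\<close>

lemma channel_graph_cong:
  assumes "channel_graph n t = channel_graph n s"
  shows "betweenness n t u = betweenness n s u" "closeness n t u = closeness n s u"
  by (simp_all add: betweenness_def closeness_def num_sp_def num_sp_through_def shortest_paths_def
        graph_dist_def assms)

lemma conn_mono:
  assumes "conn n s" "arcset n s \<subseteq> arcset n t"
  shows "conn n t"
  using assms graph_dist_mono[OF assms(2)] unfolding conn_def by (meson le_less_trans)

section \<open>Necessary conditions for equilibria\<close>

lemma nash_equilibria_arcset:
  assumes "s \<in> nash_equilibria n b c" "0 \<le> b" "1 < c"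
  shows "arcset n s = pairs n"
proof (rule ccontr)
  assume "arcset n s \<noteq> pairs n"
  then obtain u v where uv: "u < n" "v < n" "u \<noteq> v" "(u, v) \<notin> arcset n s"
    using arcset_subset_pairs[of n s] by (auto simp: pairs_def)
  have prof: "s \<in> strategy_profiles n" and conn: "conn n s"
    using assms(1) connected_imp_conn by (auto simp: nash_equilibria_def)
  have su: "s u \<subseteq> {..<n} - {u}"
    using prof uv by (auto simp: strategy_profiles_def strategies_def)
  then have "finite (s u)" by (rule finite_subset) simp
  have "v \<notin> s u" using uv by (simp add: mem_arcset_iff)
  \<comment> \<open>The deviation: \<open>u\<close> opens the missing channel to
    \<open>v\<close>.\<close>
  define t where "t = s(u := insert v (s u))"
  have arcs: "arcset n t = arcset n s \<union> {(u, v), (v, u)}"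
    using uv by (auto simp: t_def mem_arcset_iff split: if_splits)
  have connt: "conn n t" using conn arcs by (intro conn_mono[of n s t]) auto
  \<comment> \<open>Both distances are finite, so passing to real numbers preserves their
    order.\<close>
  have hops_le: "hops n t u w \<le> hops n s u w" if "w < n" for w
    using graph_dist_mono[of n s t u w] arcs conn_hops[OF conn \<open>u < n\<close> that]
      conn_hops[OF connt \<open>u < n\<close> that]
    by (cases "graph_dist n s u w"; cases "graph_dist n t u w") auto
  have "hops n t u v = 1" using graph_dist_adjacent[of u v n t] arcs by simp
  moreover have "2 \<le> hops n s u v" using uv by (intro hops_ge_2[OF conn])
  moreover have "(\<Sum>w\<in>{..<n} - {u} - {v}. hops n t u w - 1) \<le> (\<Sum>w\<in>{..<n} - {u} - {v}. hops n s u w - 1)"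
    by (intro sum_mono) (simp add: hops_le)
  ultimately have close: "(\<Sum>w\<in>{..<n} - {u}. hops n t u w - 1) \<le> (\<Sum>w\<in>{..<n} - {u}. hops n s u w - 1) - 1"
    using uv by (simp add: sum.remove[of _ v])
  \<comment> \<open>Closeness drops by at least 1, hence its weighted value by at least
    \<open>c\<close>, which exceeds the price 1 of the channel.\<close>
  have "c * (\<Sum>w\<in>{..<n} - {u}. hops n t u w - 1) < c * (\<Sum>w\<in>{..<n} - {u}. hops n s u w - 1) - 1"
    using mult_left_mono[OF close, of c] assms(3) by (simp add: algebra_simps)
  moreover have "b * betweenness n t u \<le> b * betweenness n s u"
    using betweenness_add_edge[OF arcs conn] assms(2) by (rule mult_left_mono)
  moreover have "card (t u) = card (s u) + 1"
    using \<open>finite (s u)\<close> \<open>v \<notin> s u\<close> by (simp add: t_def)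
  ultimately have "player_cost n b c t u < player_cost n b c s u"
    by (simp add: player_cost_conn[OF conn \<open>u < n\<close>] player_cost_conn[OF connt \<open>u < n\<close>])
  moreover have "insert v (s u) \<in> strategies n u" using su uv by (auto simp: strategies_def)
  ultimately show False using assms(1) uv(1) by (auto simp: nash_equilibria_def t_def)
qed

text \<open>Giving up one of the two copies of a channel leaves the graph unchanged and saves
  1.\<close>

lemma nash_equilibria_single_channel:
  assumes "s \<in> nash_equilibria n b c" "u < n" "v < n" "v \<in> s u"
  shows "u \<notin> s v"
proof
  assume "u \<in> s v"
  have prof: "s \<in> strategy_profiles n" and conn: "conn n s"
    using assms(1) connected_imp_conn by (auto simp: nash_equilibria_def)
  have su: "s u \<subseteq> {..<n} - {u}"
    using prof assms by (auto simp: strategy_profiles_def strategies_def)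
  then have "finite (s u)" by (rule finite_subset) simp
  have "u \<noteq> v" using su assms by auto
  define t where "t = s(u := s u - {v})"
  have eq: "channel_graph n t = channel_graph n s"
    using \<open>u \<in> s v\<close> \<open>u \<noteq> v\<close> by (auto simp: t_def channel_graph_def split: if_splits)
  have "card (t u) < card (s u)"
    using \<open>finite (s u)\<close> assms unfolding t_def by (simp only: fun_upd_same card_Diff1_less)
  \<comment> \<open>Finiteness of the closeness keeps the inequality strict; adding infinity to both
    sides would destroy it.\<close>
  then have "player_cost n b c t u < player_cost n b c s u"
    using closeness_conn[OF conn \<open>u < n\<close>]
    by (simp add: player_cost_def channel_graph_cong[OF eq])
  moreover have "s u - {v} \<in> strategies n u" using su by (auto simp: strategies_def)
  ultimately show False using assms(1,2) by (auto simp: nash_equilibria_def t_def)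
qed

section \<open>Counting channels and arcs\<close>

lemma strategy_profile_subset:
  assumes "s \<in> strategy_profiles n" "u < n"
  shows "s u \<subseteq> {..<n} - {u}"
  using assms by (auto simp: strategy_profiles_def strategies_def)

lemma sum_card_eq_card_Sigma:
  assumes "s \<in> strategy_profiles n"
  shows "(\<Sum>u<n. card (s u)) = card (SIGMA u:{..<n}. s u)"
proof -
  have "finite (s u)" if "u < n" for u
    using assms that by (auto simp: strategy_profiles_def strategies_def intro: finite_subset)
  then show ?thesis by simp
qed

text \<open>The opened channels form a relation whose symmetric closure is the arc set. Arc counts
  thus become cardinalities of a union of two sets of equal size, disjoint if no channel is opened
  twice.\<close>

lemma arcset_eq_Sigma:
  assumes "s \<in> strategy_profiles n"
  shows "arcset n s = (SIGMA u:{..<n}. s u) \<union> (SIGMA u:{..<n}. s u)\<inverse>"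
  using strategy_profile_subset[OF assms] by (fastforce simp: mem_arcset_iff)

lemma finite_Sigma_strategies:
  assumes "s \<in> strategy_profiles n"
  shows "finite (SIGMA u:{..<n}. s u)"
  by (rule finite_subset[OF _ finite_arcset[of n s]]) (auto simp: arcset_eq_Sigma[OF assms])

lemma card_arcset_le:
  assumes "s \<in> strategy_profiles n"
  shows "card (arcset n s) \<le> 2 * (\<Sum>u<n. card (s u))"
proof -
  have "card (arcset n s) \<le> card (SIGMA u:{..<n}. s u) + card ((SIGMA u:{..<n}. s u)\<inverse>)"
    unfolding arcset_eq_Sigma[OF assms] by (rule card_Un_le)
  then show ?thesis by (simp add: sum_card_eq_card_Sigma[OF assms] del: card_SigmaI)
qed

lemma card_arcset_single_channel:
  assumes "s \<in> strategy_profiles n"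
    and "\<And>u v. u < n \<Longrightarrow> v < n \<Longrightarrow> v \<in> s u \<Longrightarrow> u \<notin> s v"
  shows "card (arcset n s) = 2 * (\<Sum>u<n. card (s u))"
proof -
  have "(SIGMA u:{..<n}. s u) \<inter> (SIGMA u:{..<n}. s u)\<inverse> = {}"
    using assms by (auto simp: strategy_profiles_def strategies_def)
  then have "card (arcset n s) = card (SIGMA u:{..<n}. s u) + card ((SIGMA u:{..<n}. s u)\<inverse>)"
    unfolding arcset_eq_Sigma[OF assms(1)]
    by (intro card_Un_disjoint) (simp_all add: finite_Sigma_strategies[OF assms(1)])
  then show ?thesis by (simp add: sum_card_eq_card_Sigma[OF assms(1)] del: card_SigmaI)
qed

section \<open>Complete graphs are equilibria\<close>

lemma conn_complete:
  assumes "arcset n s = pairs n"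
  shows "conn n s"
  unfolding conn_def
proof (intro allI impI)
  fix i j assume "i < n" "j < n"
  then show "graph_dist n s i j < \<infinity>"
    using graph_dist_self[of i n s] graph_dist_adjacent[of i j n s] assms
    by (cases "i = j") (auto simp: pairs_def)
qed

lemma social_cost_complete:
  assumes "s \<in> strategy_profiles n" "arcset n s = pairs n"
    and "\<And>u v. u < n \<Longrightarrow> v < n \<Longrightarrow> v \<in> s u \<Longrightarrow> u \<notin> s v"
  shows "social_cost n b c s
           = ereal (real n * (real n - 1) / 2 + b * (real n * (real n - 1) * (real n - 2)))"
proof -
  have "stretch n s = 0"
    unfolding stretch_def using assms(2) by (intro sum.neutral) (auto simp: graph_dist_adjacent)
  moreover have "real (card (pairs n)) = real n * (real n - 1)"
    by (rule real_card_pairs)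
  moreover have "real (card (arcset n s)) = 2 * real (\<Sum>u<n. card (s u))"
    by (simp only: card_arcset_single_channel[OF assms(1,3)] of_nat_mult of_nat_numeral)
  ultimately show ?thesis
    by (simp add: social_cost_conn[OF conn_complete[OF assms(2)]] assms(2))
qed

text \<open>Shortest paths between the other players are single arcs and have no inner vertex. Arcs
  at \<open>u\<close> are left open, so that the lemma covers every deviation of \<open>u\<close>
  too.\<close>

lemma betweenness_clique:
  assumes "\<And>i j. (i, j) \<in> pairs n \<Longrightarrow> i \<noteq> u \<Longrightarrow> j \<noteq> u \<Longrightarrow> (i, j) \<in> arcset n s"
  shows "betweenness n s u = (real n - 1) * (real n - 2)"
proof -
  have "through_ratio n s u i j = 0" if "(i, j) \<in> pairs n" for i j
  proof (cases "u = i \<or> u = j")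
    case False
    then have "graph_dist n s i j = 1" using assms that by (intro graph_dist_adjacent) auto
    then have dist: "graph_dist n s i j = ereal (real 1)" by (simp add: one_ereal_def)
    have "u \<notin> set (walk_verts i p)" if p: "path n s i p j" "length p = 1" for p
    proof -
      obtain e where "p = [e]" using p(2) by (auto simp: length_Suc_conv)
      then show ?thesis
        using p(1) False by (auto simp: walk_verts_def pre_digraph.apath_def pre_digraph.awalk_def pre_digraph.cas.simps)
    qed
    then have "{p \<in> shortest_paths n s i j. u \<in> set (walk_verts i p)} = {}"
      using shortest_paths_iff[OF dist] by blast
    then have "num_sp_through n s u i j = 0"
      by (simp only: num_sp_through_def awalk_verts_net card.empty)
    then show ?thesis by (simp add: through_ratio_def)
  qed (auto simp: through_ratio_def)
  then show ?thesis by (auto simp: betweenness_eq intro!: sum.neutral)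
qed

lemma nash_equilibria_complete:
  assumes "s \<in> strategy_profiles n" "arcset n s = pairs n" "0 < n" "1 < c"
    and single: "\<And>u v. u < n \<Longrightarrow> v < n \<Longrightarrow> v \<in> s u \<Longrightarrow> u \<notin> s v"
  shows "s \<in> nash_equilibria n b c"
proof -
  have "player_cost n b c s u \<le> player_cost n b c (s(u := t)) u"
    if u: "u < n" and t: "t \<in> strategies n u" for u t
  proof -
    let ?s = "s(u := t)"
    have su: "s u \<subseteq> {..<n} - {u}"
      using assms u by (auto simp: strategy_profiles_def strategies_def)
    have "t \<subseteq> {..<n} - {u}" using t by (simp add: strategies_def)
    then have fin: "finite (s u)" "finite t" using su by (auto intro: finite_subset)
    have "(i, j) \<in> arcset n ?s" if "(i, j) \<in> pairs n" "i \<noteq> u" "j \<noteq> u" for i j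
      using that assms(2) by (auto simp: mem_arcset_iff set_eq_iff pairs_def)
    then have bs: "betweenness n ?s u = (real n - 1) * (real n - 2)" by (rule betweenness_clique)
    have b: "betweenness n s u = (real n - 1) * (real n - 2)"
      using assms(2) by (intro betweenness_clique) auto
    have "closeness n s u = 0"
      unfolding closeness_def using assms(2) u
      by (intro sum.neutral) (auto simp: graph_dist_adjacent pairs_def)
    \<comment> \<open>The estimate stays in \<open>ereal\<close>, because the deviation may isolate
      \<open>u\<close>. Each channel given up raises its distance by at least 1.\<close>
    have "ereal (card (s u - t)) = (\<Sum>v\<in>s u - t. 1)"
      by (simp add: one_ereal_def)
    also have "\<dots> \<le> (\<Sum>v\<in>s u - t. graph_dist n ?s u v - 1)"
    proof (rule sum_mono)
      fix v assume v: "v \<in> s u - t"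
      \<comment> \<open>By \<open>single\<close>, \<open>v\<close> has not opened the channel from
        the other end, so closing it removes the edge.\<close>
      then have "(u, v) \<notin> arcset n ?s" "u \<noteq> v"
        using single[of u v] su u by (auto simp: mem_arcset_iff)
      then have "2 \<le> graph_dist n ?s u v" by (intro graph_dist_ge_2)
      then show "1 \<le> graph_dist n ?s u v - 1"
        by (cases "graph_dist n ?s u v") (auto simp: one_ereal_def)
    qed
    also have "\<dots> \<le> closeness n ?s u"
      unfolding closeness_def
    proof (rule sum_mono2)
      show "s u - t \<subseteq> {..<n} - {u}" using su by blast
      show "0 \<le> graph_dist n ?s u v - 1" if "v \<in> {..<n} - {u} - (s u - t)" for v
        using graph_dist_ge_1[of u v n ?s] that by (simp add: ereal_diff_positive)
    qed simp
    also have "closeness n ?s u \<le> ereal c * closeness n ?s u"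
      using ereal_mult_right_mono[of 1 "ereal c" "closeness n ?s u"] closeness_nonneg[of n ?s u] assms(4)
      by simp
    finally have close: "ereal (card (s u - t)) \<le> ereal c * closeness n ?s u" .
    have "card (s u) \<le> card (t \<union> (s u - t))" using fin by (intro card_mono) auto
    also have "\<dots> \<le> card t + card (s u - t)" by (rule card_Un_le)
    finally have "ereal (card (s u)) \<le> ereal (card t) + ereal (card (s u - t))" by simp
    also have "\<dots> \<le> ereal (card t) + ereal c * closeness n ?s u"
      using close by (rule add_left_mono)
    finally have "ereal (card (s u)) + ereal (b * ((real n - 1) * (real n - 2)))
        \<le> ereal (card t) + ereal c * closeness n ?s u + ereal (b * ((real n - 1) * (real n - 2)))"
      by (rule add_right_mono)
    then show ?thesis
      unfolding player_cost_def \<open>closeness n s u = 0\<close> b bs by (simp add: ac_simps del: plus_ereal.simps)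
  qed
  then show ?thesis
    using assms(1) conn_imp_connected[OF conn_complete[OF assms(2)] assms(3)]
    by (auto simp: nash_equilibria_def not_less)
qed

text \<open>A witness that equilibria exist, so that the maximum is taken over a nonempty set: each
  edge is opened by its larger end. The restriction to \<open>{..<n}\<close> makes it an extensional
  function, as \<open>strategy_profiles\<close> demands.\<close>

definition upward_complete :: "nat \<Rightarrow> nat \<Rightarrow> nat set" where
  "upward_complete n = (\<lambda>u\<in>{..<n}. {..<u})"

lemma social_cost_nash_equilibria:
  assumes "0 < n" "0 \<le> b" "1 < c"
  shows "social_cost n b c ` nash_equilibria n b c
           = {ereal (real n * (real n - 1) / 2 + b * (real n * (real n - 1) * (real n - 2)))}"
proof -
  have "upward_complete n \<in> strategy_profiles n"
    by (auto simp: upward_complete_def strategy_profiles_def strategies_def)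
  moreover have "arcset n (upward_complete n) = pairs n"
    by (auto simp: mem_arcset_iff pairs_def upward_complete_def)
  ultimately have "upward_complete n \<in> nash_equilibria n b c"
    using assms by (intro nash_equilibria_complete) (auto simp: upward_complete_def)
  moreover have "social_cost n b c s
      = ereal (real n * (real n - 1) / 2 + b * (real n * (real n - 1) * (real n - 2)))"
    if "s \<in> nash_equilibria n b c" for s
    using that nash_equilibria_arcset[OF that assms(2,3)] nash_equilibria_single_channel[OF that]
    by (intro social_cost_complete) (auto simp: nash_equilibria_def)
  ultimately show ?thesis by (intro equalityI subsetI) auto
qed

section \<open>The minimal social cost: lower bound\<close>

text \<open>The vertex before \<open>v\<close> on a shortest path from \<open>r\<close> is one hop
  closer to \<open>r\<close>; it will be the parent of \<open>v\<close> in a breadth-first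
  tree.\<close>

lemma conn_predecessor:
  assumes "conn n s" "v < n" "v \<noteq> r" "r < n"
  obtains w where "(v, w) \<in> arcset n s" "hops n s r v = hops n s r w + 1"
proof -
  interpret pair_graph "channel_graph n s" by (rule pair_graph_channel_graph)
  have "graph_dist n s r v < \<infinity>" using assms by (simp add: conn_def)
  then have "r \<rightarrow>\<^sup>*\<^bsub>net n s\<^esub> v" unfolding graph_dist_def \<mu>_reach_conv .
  then obtain w e where w: "\<mu> (\<lambda>_. 1) r v = \<mu> (\<lambda>_. 1) r w + ereal 1" "arc e (w, v)"
    using mu_exact_triangle[of v r "\<lambda>_. 1"] assms(3) by auto
  then have "(w, v) \<in> arcset n s" by (auto simp: arc_def)
  then have "(v, w) \<in> arcset n s" "w < n" by (auto simp: mem_arcset_iff)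
  moreover have "hops n s r v = hops n s r w + 1"
    using w(1) conn_hops[OF assms(1,4) \<open>w < n\<close>] unfolding graph_dist_def[symmetric]
    by (cases "graph_dist n s r w") auto
  ultimately show ?thesis using that by blast
qed

text \<open>The \<open>n - 1\<close> edges of a breadth-first tree rooted at player 0 give two arcs
  each: \<open>f\<close> is the parent map, \<open>A\<close> holds the arcs towards the root and
  \<open>B\<close> those away from it.\<close>

lemma card_arcset_ge:
  assumes "conn n s"
  shows "2 * (n - 1) \<le> card (arcset n s)"
proof (cases "n = 0")
  case False
  have "\<exists>w. (v, w) \<in> arcset n s \<and> hops n s 0 v = hops n s 0 w + 1" if "v \<in> {1..<n}" for v
    using conn_predecessor[OF assms, of v 0] that by auto
  then obtain f where f: "\<And>v. v \<in> {1..<n} \<Longrightarrow> (v, f v) \<in> arcset n s \<and> hops n s 0 v = hops n s 0 (f v) + 1"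
    by metis
  define A where "A = (\<lambda>v. (v, f v)) ` {1..<n}"
  define B where "B = (\<lambda>v. (f v, v)) ` {1..<n}"
  have "A \<inter> B = {}"
  proof (rule equals0I)
    fix x assume "x \<in> A \<inter> B"
    then obtain v w where "v \<in> {1..<n}" "w \<in> {1..<n}" "v = f w" "f v = w"
      by (auto simp: A_def B_def)
    \<comment> \<open>Two players cannot be each other's parents: each would be one hop farther from
      the root than the other.\<close>
    then show False using f[of v] f[of w] by simp
  qed
  then have "card (A \<union> B) = card A + card B"
    by (intro card_Un_disjoint) (simp_all add: A_def B_def)
  moreover have "card A = n - 1" "card B = n - 1"
    by (simp_all add: A_def B_def card_image inj_on_def)
  moreover have "A \<union> B \<subseteq> arcset n s"
    using f arcset_sym unfolding A_def B_def by blast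
  then have "card (A \<union> B) \<le> card (arcset n s)" by (intro card_mono finite_arcset)
  ultimately show ?thesis by simp
qed simp

lemma card_pairs_minus_arcset:
  "real (card (pairs n - arcset n s)) = real n * (real n - 1) - card (arcset n s)"
proof -
  have "card (arcset n s) \<le> card (pairs n)" by (intro card_mono finite_pairs arcset_subset_pairs)
  moreover have "real (card (pairs n)) = real n * (real n - 1)"
    by (rule real_card_pairs)
  ultimately show ?thesis
    by (simp add: card_Diff_subset[OF finite_arcset arcset_subset_pairs] of_nat_diff)
qed

lemma stretch_eq:
  "stretch n s = (\<Sum>(i, j)\<in>pairs n - arcset n s. hops n s i j - 1)"
  unfolding stretch_def
  by (rule sum.mono_neutral_right[OF finite_pairs]) (auto simp: graph_dist_adjacent)

lemma stretch_ge:
  assumes "conn n s"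
  shows "real n * (real n - 1) - card (arcset n s) \<le> stretch n s"
proof -
  have "real (card (pairs n - arcset n s)) = (\<Sum>x\<in>pairs n - arcset n s. 1)" by simp
  also have "\<dots> \<le> stretch n s"
    unfolding stretch_eq
  proof (intro sum_mono, safe)
    fix i j assume "(i, j) \<in> pairs n" "(i, j) \<notin> arcset n s"
    then show "1 \<le> hops n s i j - 1" using hops_ge_2[OF assms, of i j] by (auto simp: pairs_def)
  qed
  finally show ?thesis by (simp only: card_pairs_minus_arcset)
qed

text \<open>The equality case of \<open>stretch_ge\<close>: non-adjacent players are at distance
  exactly 2.\<close>

lemma stretch_diameter_2:
  assumes "\<And>i j. i < n \<Longrightarrow> j < n \<Longrightarrow> graph_dist n s i j \<le> 2"
  shows "stretch n s = real n * (real n - 1) - card (arcset n s)"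
proof -
  have "stretch n s = (\<Sum>x\<in>pairs n - arcset n s. 1)"
    unfolding stretch_eq
  proof (intro sum.cong refl, safe)
    fix i j assume ij: "(i, j) \<in> pairs n" "(i, j) \<notin> arcset n s"
    then have "graph_dist n s i j = 2"
      using graph_dist_ge_2[of i j n s] assms[of i j] by (auto simp: pairs_def intro: antisym)
    then show "hops n s i j - 1 = 1" by simp
  qed
  then show ?thesis by (simp add: card_pairs_minus_arcset)
qed

lemma social_cost_ge:
  assumes "s \<in> strategy_profiles n" "0 < n" "0 < c" "b \<le> c" "c \<le> 1 / 2 + b"
  shows "ereal ((real n - 1) * (1 + (c + b * (real n - 1)) * (real n - 2))) \<le> social_cost n b c s"
proof (cases "conn n s")
  case True
  define a where "a = real (card (arcset n s))"
  have "real (card (arcset n s)) \<le> real (2 * (\<Sum>u<n. card (s u)))"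
    using card_arcset_le[OF assms(1)] by (simp only: of_nat_le_iff)
  then have K: "a / 2 \<le> real (\<Sum>u<n. card (s u))" by (simp add: a_def)
  have "real (2 * (n - 1)) \<le> a" unfolding a_def using card_arcset_ge[OF True] by (simp only: of_nat_le_iff)
  then have a: "2 * (real n - 1) \<le> a" using assms(2) by (simp add: of_nat_diff)
  have "(c - b) * (real n * (real n - 1) - a) \<le> (c - b) * stretch n s"
    unfolding a_def using stretch_ge[OF True] assms(4) by (intro mult_left_mono) auto
  \<comment> \<open>The coefficient of \<open>a\<close> is 1/2 from the channels minus
    \<open>c - b\<close> from the stretch. It is nonnegative, so \<open>a\<close> may be replaced by
    its least value.\<close>
  moreover have "(1 / 2 - (c - b)) * (2 * (real n - 1)) \<le> (1 / 2 - (c - b)) * a"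
    using a assms(5) by (intro mult_left_mono) auto
  ultimately have "(real n - 1) * (1 + (c + b * (real n - 1)) * (real n - 2))
      \<le> real (\<Sum>u<n. card (s u)) + b * (real n * (real n - 1) * (real n - 2)) + (c - b) * stretch n s"
    using K by (simp add: algebra_simps)
  then show ?thesis by (simp add: social_cost_conn[OF True])
qed (simp add: social_cost_not_conn assms)

section \<open>The star attains the lower bound\<close>

definition star :: "nat \<Rightarrow> nat \<Rightarrow> nat set" where
  "star n = (\<lambda>u\<in>{..<n}. if u = 0 then {1..<n} else {})"

lemma star_in_strategy_profiles: "star n \<in> strategy_profiles n"
  by (auto simp: star_def strategy_profiles_def strategies_def split: if_splits)

text \<open>All estimates in \<open>social_cost_ge\<close> are equalities here: every channel is
  opened once, there are \<open>2 * (n - 1)\<close> arcs, and no distance exceeds 2.\<close>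

lemma social_cost_star:
  assumes "0 < n"
  shows "social_cost n b c (star n) = ereal ((real n - 1) * (1 + (c + b * (real n - 1)) * (real n - 2)))"
proof -
  have arcs: "(i, j) \<in> arcset n (star n) \<longleftrightarrow> i < n \<and> j < n \<and> i \<noteq> j \<and> (i = 0 \<or> j = 0)" for i j
    by (auto simp: mem_arcset_iff star_def)
  have dist: "graph_dist n (star n) i j \<le> 2" if "i < n" "j < n" for i j
  proof -
    consider "i = j" | "i \<noteq> j" "i = 0 \<or> j = 0" | "i \<noteq> 0" "j \<noteq> 0" by blast
    then show ?thesis
    proof cases
      case 1
      then show ?thesis using that by (simp add: graph_dist_self)
    next
      case 2
      then have "graph_dist n (star n) i j = 1" using that by (intro graph_dist_adjacent) (simp add: arcs)
      then show ?thesis by (simp add: one_ereal_def)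
    next
      case 3
      \<comment> \<open>Two leaves are joined through the centre 0.\<close>
      then show ?thesis using that by (intro graph_dist_le_2[of i 0]) (simp_all add: arcs)
    qed
  qed
  have "conn n (star n)"
    unfolding conn_def
  proof (intro allI impI)
    fix i j assume "i < n" "j < n"
    then have "graph_dist n (star n) i j \<le> 2" by (rule dist)
    also have "(2 :: ereal) < \<infinity>" by simp
    finally show "graph_dist n (star n) i j < \<infinity>" .
  qed
  have "(\<Sum>u<n. card (star n u)) = (\<Sum>u<n. if u = 0 then n - 1 else 0)"
    by (intro sum.cong) (simp_all add: star_def)
  also have "\<dots> = n - 1" using assms by (simp add: sum.delta)
  finally have K: "(\<Sum>u<n. card (star n u)) = n - 1" .
  have "card (arcset n (star n)) = 2 * (\<Sum>u<n. card (star n u))"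
    by (intro card_arcset_single_channel star_in_strategy_profiles) (auto simp: star_def split: if_splits)
  then have "real (card (arcset n (star n))) = 2 * (real n - 1)"
    using assms by (simp add: K of_nat_diff)
  then have "stretch n (star n) = real n * (real n - 1) - 2 * (real n - 1)"
    using stretch_diameter_2[OF dist] by simp
  then have "social_cost n b c (star n) = ereal (real (n - 1)
      + b * (real n * (real n - 1) * (real n - 2)) + (c - b) * (real n * (real n - 1) - 2 * (real n - 1)))"
    by (simp only: social_cost_conn[OF \<open>conn n (star n)\<close>] K)
  then show ?thesis using assms by (simp add: of_nat_diff algebra_simps)
qed

section \<open>The price of anarchy\<close>

theorem corollary2:
  fixes n :: nat and b c :: real
  assumes "n \<ge> 2" and "b \<ge> 0" and "c > 1" and "b \<le> c" and "c \<le> 1 / 2 + b"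
  shows "PoA n b c =
    ereal (((1 / 2 + (real n - 2) * b) * real n) / (1 + (c + b * (real n - 1)) * (real n - 2)))"
proof -
  \<comment> \<open>The minimal cost is \<open>(n - 1) * B\<close>.\<close>
  define B where "B = 1 + (c + b * (real n - 1)) * (real n - 2)"
  have "0 < n" using assms(1) by simp
  have "0 < B" unfolding B_def using assms by (intro add_pos_nonneg mult_nonneg_nonneg) auto
  have "Min (social_cost n b c ` strategy_profiles n) = ereal ((real n - 1) * B)"
  proof (rule Min_eqI)
    show "finite (social_cost n b c ` strategy_profiles n)" by (simp add: finite_strategy_profiles)
    show "ereal ((real n - 1) * B) \<le> x" if "x \<in> social_cost n b c ` strategy_profiles n" for x
      using that social_cost_ge[of _ n c b] assms by (auto simp: B_def)
    show "ereal ((real n - 1) * B) \<in> social_cost n b c ` strategy_profiles n"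
      unfolding B_def social_cost_star[OF \<open>0 < n\<close>, symmetric]
      by (intro imageI star_in_strategy_profiles)
  qed
  then have "PoA n b c = ereal (real n * (real n - 1) / 2 + b * (real n * (real n - 1) * (real n - 2)))
      / ereal ((real n - 1) * B)"
    by (simp add: PoA_def social_cost_nash_equilibria[OF \<open>0 < n\<close> assms(2,3)])
  \<comment> \<open>The numerator contains the factor \<open>n - 1\<close> as well; it is positive
    for \<open>n \<ge> 2\<close> and cancels.\<close>
  also have "real n * (real n - 1) / 2 + b * (real n * (real n - 1) * (real n - 2))
      = (real n - 1) * ((1 / 2 + (real n - 2) * b) * real n)"
    by (simp add: algebra_simps)
  finally show ?thesis using assms(1) \<open>0 < B\<close> by (simp add: B_def)
qed

end
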